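(* Assume: (A1) the probabilities $\{p_t\}_{t\in\mathbb{N}}$ satisfy $\sum_{t=1}^\infty p_t=\infty$; (A2) for every $\bm{x}\in\Omega$ and $\eta>0$ there exist $\bm{x}'\in\Omega$ and a cost $c_i$ such that $\mathrm{P}(\bm{S}(\bm{x}',c_i)\in\mathscr{N}(\bm{x};\eta))>0$, where $\mathscr{N}(\bm{x};\eta)=\{\bm{a}\in D:\|\bm{a}-\bm{x}\|<\eta\}$; (A3) for every $\bm{x}\in\Omega$, the kernel $k$ is continuous at $(\bm{x},\bm{x})$. Then for any $h\in\mathbb{R}$, $\epsilon>0$ and $\beta>0$, if the trials of Algorithm 1 (described in the context) are continued forever without applying the termination condition, with probability 1 it holds for every $\bm{x}\in\Omega$ that $$\sigma_t^2(\bm{x})\to0\quad(t\to\infty).$$ Furthermore, with probability 1, the number of evaluations of points required to complete Algorithm 1 (i.e. to reach $U_t=\emptyset$) is finite.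
   Context: Setting. $D\subset\mathbb{R}^d$, $\Omega\subset D$ is a nonempty finite set, and $f:D\to\mathbb{R}$ is a black-box function modelled with a Gaussian process prior $\mathcal{GP}(0,k)$ with positive-definite kernel $k:D\times D\to\mathbb{R}$. There are costs $0<c_1<\dots<c_K$. If the point $\bm{x}\in\Omega$ is requested with cost $c_i$, the point actually evaluated is a random sample $\bm{s}\in D$ of a random variable $\bm{S}(\bm{x},c_i)$ with density $g(\cdot\mid\theta_{\bm{x}}^{(c_i)})$, and one observes $\bm{s}$ and $y=f(\bm{s})+\varrho$ with independent noise $\varrho\sim\mathcal{N}(0,\sigma^2)$, $\sigma^2>0$. Posterior. After $t$ trials with evaluated points $\bm{s}_1,\dots,\bm{s}_t$ and observations $\bm{y}_t=(y_1,\dots,y_t)^\top$, put $\bm{k}_t(\bm{x})=(k(\bm{s}_1,\bm{x}),\dots,k(\bm{s}_t,\bm{x}))^\top$, $\bm{K}_t=(k(\bm{s}_i,\bm{s}_j))_{i,j}$, $\bm{C}_t=\bm{K}_t+\sigma^2\bm{I}_t$, and $\mu_t(\bm{x})=\bm{k}_t(\bm{x})^\top\bm{C}_t^{-1}\bm{y}_t$, $k_t(\bm{x},\bm{x}')=k(\bm{x},\bm{x}')-\bm{k}_t(\bm{x})^\top\bm{C}_t^{-1}\bm{k}_t(\bm{x}')$, $\sigma_t^2(\bm{x})=k_t(\bm{x},\bm{x})$. (If a finite, possibly empty, set of initial training data from the same observation model is supplied, it is included in the conditioning as well.) Classification. For threshold $h$ and parameters $\beta,\epsilon$, let $l_t(\bm{x})=\mu_t(\bm{x})-\beta^{1/2}\sigma_t(\bm{x})$,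 $u_t(\bm{x})=\mu_t(\bm{x})+\beta^{1/2}\sigma_t(\bm{x})$, and $H_t=\{\bm{x}\in\Omega: l_t(\bm{x})>h-\epsilon\}$, $L_t=\{\bm{x}\in\Omega: u_t(\bm{x})<h+\epsilon\}$, $U_t=\Omega\setminus(H_t\cup L_t)$ for $t\ge1$, with $U_0=\Omega$. Acquisition function. For a hypothetical new data point $(\bm{s}^*,y^* )$, let $HL_t(\bm{s}^*,y^* )$ be the union of the two estimated sets recomputed after adding $(\bm{s}^*,y^* )$ to the current data, let $HL_t=H_t\cup L_t$, and $a_t(\bm{x},c_i)=c_i^{-1}\big\{\int \mathrm{E}_{y^*}\big[|HL_t(\bm{s}^*,y^* )|\big]\,g(\bm{s}^*\mid\theta_{\bm{x}}^{(c_i)})\,d\bm{s}^*-|HL_t|\big\}$, where $y^*\sim\mathcal{N}(\mu_t(\bm{s}^* ),\sigma_t^2(\bm{s}^* )+\sigma^2)$. Algorithm 1. Given $p_1,p_2,\dots\in[0,1]$ and $\kappa_1,\dots,\kappa_K\in(0,1)$ with $|\Omega|\sum_{i=1}^K\kappa_i=1$. As long as $U_{t-1}\neq\emptyset$, trial $t$ is performed: draw independently $r_t\sim$ Bernoulli$(p_t)$; if $r_t=0$ choose $(\bm{x}_t,c_{i_t})$ maximizing the acquisition function (computed from the current data) over $\Omega\times\{c_1,\dots,c_K\}$; if $r_t=1$ draw $(\bm{x}_t,c_{i_t})=C_t$, where, independently of everything else, $\mathrm{P}(C_t=(\bm{x},c_i))=\kappa_i$ for each $\bm{x}\in\Omega$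 and each $i$. Then sample $\bm{s}_t$ from $\bm{S}(\bm{x}_t,c_{i_t})$ (independently of the past given $(\bm{x}_t,c_{i_t})$), observe $y_t=f(\bm{s}_t)+\varrho_t$, and update. The algorithm completes after $t$ trials if $t$ is the first index with $U_t=\emptyset$. *)

theory Defs
  imports
    "HOL-Probability.Probability"
    "Jordan_Normal_Form.Gauss_Jordan_Elimination"
begin

section \<open>Gaussian process prior and posterior\<close>

text \<open>Positive definiteness of a kernel is meant in the usual sense of the kernel literature:
  all Gram matrices are positive semidefinite.\<close>

definition pd_kernel :: "'a set \<Rightarrow> ('a \<Rightarrow> 'a \<Rightarrow> real) \<Rightarrow> bool" where
  "pd_kernel D k \<longleftrightarrow>
     (\<forall>x\<in>D. \<forall>x'\<in>D. k x x' = k x' x) \<and>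
     (\<forall>A a. finite A \<and> A \<subseteq> D \<longrightarrow> 0 \<le> (\<Sum>x\<in>A. \<Sum>x'\<in>A. a x * a x' * k x x'))"

text \<open>The law N(0, w) on the reals, degenerate for w = 0.\<close>

definition centred_normal :: "real \<Rightarrow> real measure" where
  "centred_normal w =
     (if w = 0 then return borel 0 else density lborel (\<lambda>z. ennreal (normal_density 0 (sqrt w) z)))"

text \<open>The process f has law GP(0, k) on D: its finite-dimensional distributions are multivariate
  normal, i.e. every finite linear combination is normal with mean and variance given by
  the mean function 0 and the covariance function k.\<close>

definition gaussian_process ::
    "'w measure \<Rightarrow> 'a set \<Rightarrow> ('a \<Rightarrow> 'a \<Rightarrow> real) \<Rightarrow> ('a \<Rightarrow> 'w \<Rightarrow> real) \<Rightarrow> bool" where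
  "gaussian_process M D k f \<longleftrightarrow>
     (\<forall>x\<in>D. f x \<in> borel_measurable M) \<and>
     (\<forall>A a. finite A \<and> A \<subseteq> D \<longrightarrow>
        distr M borel (\<lambda>\<omega>. \<Sum>x\<in>A. a x * f x \<omega>) =
        centred_normal (\<Sum>x\<in>A. \<Sum>x'\<in>A. a x * a x' * k x x'))"

text \<open>Data are lists of pairs (evaluated point, observation); \<open>v\<close> is the variance of the
  observation noise. The matrix inverted below is positive definite when \<open>v > 0\<close> and the points
  lie in the domain of a positive-definite kernel, so \<open>mat_inverse\<close> does not return \<open>None\<close>.
  With no data, the posterior is the prior.\<close>

definition kernel_vec :: "('a \<Rightarrow> 'a \<Rightarrow> real) \<Rightarrow> ('a \<times> real) list \<Rightarrow> 'a \<Rightarrow> real vec" where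
  "kernel_vec k obs x = vec (length obs) (\<lambda>i. k (fst (obs ! i)) x)"

definition kernel_mat :: "('a \<Rightarrow> 'a \<Rightarrow> real) \<Rightarrow> ('a \<times> real) list \<Rightarrow> real mat" where
  "kernel_mat k obs =
     mat (length obs) (length obs) (\<lambda>(i, j). k (fst (obs ! i)) (fst (obs ! j)))"

definition obs_cov_inv :: "('a \<Rightarrow> 'a \<Rightarrow> real) \<Rightarrow> real \<Rightarrow> ('a \<times> real) list \<Rightarrow> real mat" where
  "obs_cov_inv k v obs =
     the (mat_inverse (kernel_mat k obs + v \<cdot>\<^sub>m 1\<^sub>m (length obs)))"

definition post_mean :: "('a \<Rightarrow> 'a \<Rightarrow> real) \<Rightarrow> real \<Rightarrow> ('a \<times> real) list \<Rightarrow> 'a \<Rightarrow> real" where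
  "post_mean k v obs x =
     scalar_prod (kernel_vec k obs x) (obs_cov_inv k v obs *\<^sub>v vec_of_list (map snd obs))"

definition post_cov :: "('a \<Rightarrow> 'a \<Rightarrow> real) \<Rightarrow> real \<Rightarrow> ('a \<times> real) list \<Rightarrow> 'a \<Rightarrow> 'a \<Rightarrow> real" where
  "post_cov k v obs x x' =
     k x x' - scalar_prod (kernel_vec k obs x) (obs_cov_inv k v obs *\<^sub>v kernel_vec k obs x')"

definition post_var :: "('a \<Rightarrow> 'a \<Rightarrow> real) \<Rightarrow> real \<Rightarrow> ('a \<times> real) list \<Rightarrow> 'a \<Rightarrow> real" where
  "post_var k v obs x = post_cov k v obs x x"

section \<open>Classification and acquisition function\<close>

definition lower_conf ::
    "('a \<Rightarrow> 'a \<Rightarrow> real) \<Rightarrow> real \<Rightarrow> real \<Rightarrow> ('a \<times> real) list \<Rightarrow> 'a \<Rightarrow> real" where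
  "lower_conf k v \<beta> obs x = post_mean k v obs x - sqrt \<beta> * sqrt (post_var k v obs x)"

definition upper_conf ::
    "('a \<Rightarrow> 'a \<Rightarrow> real) \<Rightarrow> real \<Rightarrow> real \<Rightarrow> ('a \<times> real) list \<Rightarrow> 'a \<Rightarrow> real" where
  "upper_conf k v \<beta> obs x = post_mean k v obs x + sqrt \<beta> * sqrt (post_var k v obs x)"

definition high_set ::
    "'a set \<Rightarrow> ('a \<Rightarrow> 'a \<Rightarrow> real) \<Rightarrow> real \<Rightarrow> real \<Rightarrow> real \<Rightarrow> real \<Rightarrow> ('a \<times> real) list \<Rightarrow> 'a set" where
  "high_set \<Omega> k v h \<epsilon> \<beta> obs = {x \<in> \<Omega>. lower_conf k v \<beta> obs x > h - \<epsilon>}"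

definition low_set ::
    "'a set \<Rightarrow> ('a \<Rightarrow> 'a \<Rightarrow> real) \<Rightarrow> real \<Rightarrow> real \<Rightarrow> real \<Rightarrow> real \<Rightarrow> ('a \<times> real) list \<Rightarrow> 'a set" where
  "low_set \<Omega> k v h \<epsilon> \<beta> obs = {x \<in> \<Omega>. upper_conf k v \<beta> obs x < h + \<epsilon>}"

definition classified ::
    "'a set \<Rightarrow> ('a \<Rightarrow> 'a \<Rightarrow> real) \<Rightarrow> real \<Rightarrow> real \<Rightarrow> real \<Rightarrow> real \<Rightarrow> ('a \<times> real) list \<Rightarrow> 'a set" where
  "classified \<Omega> k v h \<epsilon> \<beta> obs = high_set \<Omega> k v h \<epsilon> \<beta> obs \<union> low_set \<Omega> k v h \<epsilon> \<beta> obs"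

text \<open>The expected number of classified points after one further evaluation at \<open>s\<close>, whose
  outcome is drawn from the posterior predictive distribution.\<close>

definition expected_classified ::
    "'a set \<Rightarrow> ('a \<Rightarrow> 'a \<Rightarrow> real) \<Rightarrow> real \<Rightarrow> real \<Rightarrow> real \<Rightarrow> real \<Rightarrow> ('a \<times> real) list \<Rightarrow> 'a \<Rightarrow> real"
  where
  "expected_classified \<Omega> k v h \<epsilon> \<beta> obs s =
     (LINT y|density lborel
         (\<lambda>z. ennreal (normal_density (post_mean k v obs s) (sqrt (post_var k v obs s + v)) z)).
        real (card (classified \<Omega> k v h \<epsilon> \<beta> (obs @ [(s, y)]))))"

text \<open>\<open>g (\<theta> x c)\<close> is the Lebesgue density of the point actually evaluated when \<open>x\<close> is
  requested with cost \<open>c\<close>.\<close>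

definition acquisition ::
    "'a::euclidean_space set \<Rightarrow> 'a set \<Rightarrow> ('a \<Rightarrow> 'a \<Rightarrow> real) \<Rightarrow> real \<Rightarrow> ('p \<Rightarrow> 'a \<Rightarrow> real) \<Rightarrow>
     ('a \<Rightarrow> real \<Rightarrow> 'p) \<Rightarrow> real \<Rightarrow> real \<Rightarrow> real \<Rightarrow> ('a \<times> real) list \<Rightarrow> 'a \<Rightarrow> real \<Rightarrow> real" where
  "acquisition D \<Omega> k v g \<theta> h \<epsilon> \<beta> obs x c =
     inverse c * ((LINT s:D|lborel. expected_classified \<Omega> k v h \<epsilon> \<beta> obs s * g (\<theta> x c) s)
                  - real (card (classified \<Omega> k v h \<epsilon> \<beta> obs)))"

definition sampling_law ::
    "('p \<Rightarrow> 'a::euclidean_space \<Rightarrow> real) \<Rightarrow> ('a \<Rightarrow> real \<Rightarrow> 'p) \<Rightarrow> 'a \<Rightarrow> real \<Rightarrow> 'a measure" where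
  "sampling_law g \<theta> x c = density lborel (\<lambda>s. ennreal (g (\<theta> x c) s))"

definition nbhd :: "'a::euclidean_space set \<Rightarrow> 'a \<Rightarrow> real \<Rightarrow> 'a set" where
  "nbhd D x \<eta> = {a \<in> D. norm (a - x) < \<eta>}"

section \<open>The setting\<close>

text \<open>Costs are indexed by \<open>{1..K}\<close> and trials by the positive natural numbers.\<close>

locale level_set_problem =
  fixes D \<Omega> :: "'a::euclidean_space set"
    and k :: "'a \<Rightarrow> 'a \<Rightarrow> real"
    and v :: real
    and g :: "'p \<Rightarrow> 'a \<Rightarrow> real"
    and \<theta> :: "'a \<Rightarrow> real \<Rightarrow> 'p"
    and K :: nat
    and c :: "nat \<Rightarrow> real"
    and p \<kappa> :: "nat \<Rightarrow> real"
  assumes D_borel: "D \<in> sets borel"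
    and \<Omega>: "\<Omega> \<subseteq> D" "finite \<Omega>" "\<Omega> \<noteq> {}"
    and kernel: "pd_kernel D k"
    and noise_variance: "0 < v"
    and cost_pos: "\<And>i. i \<in> {1..K} \<Longrightarrow> 0 < c i"
    and cost_mono: "strict_mono_on {1..K} c"
    and density_measurable: "\<And>x i. x \<in> \<Omega> \<Longrightarrow> i \<in> {1..K} \<Longrightarrow> g (\<theta> x (c i)) \<in> borel_measurable borel"
    and density_nonneg: "\<And>x i s. x \<in> \<Omega> \<Longrightarrow> i \<in> {1..K} \<Longrightarrow> 0 \<le> g (\<theta> x (c i)) s"
    and sampling_prob: "\<And>x i. x \<in> \<Omega> \<Longrightarrow> i \<in> {1..K} \<Longrightarrow> prob_space (sampling_law g \<theta> x (c i))"
    and sampling_in_D: "\<And>x i. x \<in> \<Omega> \<Longrightarrow> i \<in> {1..K} \<Longrightarrow> measure (sampling_law g \<theta> x (c i)) D = 1"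
    and p_range: "\<And>t. 1 \<le> t \<Longrightarrow> p t \<in> {0..1}"
    and \<kappa>_range: "\<And>i. i \<in> {1..K} \<Longrightarrow> \<kappa> i \<in> {0<..<1}"
    and \<kappa>_sum: "real (card \<Omega>) * (\<Sum>i = 1..K. \<kappa> i) = 1"

text \<open>Events expressible through a random variable with values in \<open>N\<close>.\<close>

definition events_of :: "'w measure \<Rightarrow> ('w \<Rightarrow> 'b) \<Rightarrow> 'b measure \<Rightarrow> 'w set set" where
  "events_of M X N = {X -` A \<inter> space M | A. A \<in> sets N}"

text \<open>Independence of a random variable from the information generated by a family of events.\<close>

definition indep_of :: "'w measure \<Rightarrow> ('w \<Rightarrow> 'b) \<Rightarrow> 'b measure \<Rightarrow> 'w set set \<Rightarrow> bool" where
  "indep_of M X N \<G> \<longleftrightarrow>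
     prob_space.indep_set M (events_of M X N) (sigma_sets (space M) \<G>)"

text \<open>The processes of a run. Initial data \<open>(s0 j, y0 j)\<close> for \<open>j < n0\<close> may be empty. In trial
  \<open>t \<ge> 1\<close>: \<open>r t\<close> is the Bernoulli draw (\<open>True\<close> for 1), \<open>C t\<close> the random (point, cost index) pair,
  \<open>Q t\<close> the pair actually requested, \<open>s t\<close> the evaluated point, \<open>\<rho> t\<close> the noise and \<open>y t\<close> the
  observation. Values at \<open>t = 0\<close> are irrelevant.\<close>

locale run_processes =
  level_set_problem D \<Omega> k v g \<theta> K c p \<kappa> + prob_space M
  for D \<Omega> :: "'a::euclidean_space set" and k v and g :: "'p \<Rightarrow> 'a \<Rightarrow> real" and \<theta> K c p \<kappa>
    and M :: "'w measure" +
  fixes h \<epsilon> \<beta> :: real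
    and f :: "'a \<Rightarrow> 'w \<Rightarrow> real"
    and n0 :: nat
    and s0 :: "nat \<Rightarrow> 'w \<Rightarrow> 'a"
    and \<rho>0 y0 :: "nat \<Rightarrow> 'w \<Rightarrow> real"
    and r :: "nat \<Rightarrow> 'w \<Rightarrow> bool"
    and C Q :: "nat \<Rightarrow> 'w \<Rightarrow> 'a \<times> nat"
    and s :: "nat \<Rightarrow> 'w \<Rightarrow> 'a"
    and \<rho> y :: "nat \<Rightarrow> 'w \<Rightarrow> real"
begin

abbreviation requests :: "('a \<times> nat) set" where
  "requests \<equiv> \<Omega> \<times> {1..K}"

definition data :: "nat \<Rightarrow> 'w \<Rightarrow> ('a \<times> real) list" where
  "data t \<omega> = map (\<lambda>j. (s0 j \<omega>, y0 j \<omega>)) [0..<n0] @ map (\<lambda>u. (s u \<omega>, y u \<omega>)) [1..<Suc t]"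

definition init_info :: "nat \<Rightarrow> 'w set set" where
  "init_info j =
     (\<Union>a\<in>D. events_of M (f a) borel) \<union>
     (\<Union>i<j. events_of M (s0 i) borel \<union> events_of M (\<rho>0 i) borel \<union> events_of M (y0 i) borel)"

definition decision_info :: "nat \<Rightarrow> 'w set set" where
  "decision_info t =
     events_of M (r t) (count_space UNIV) \<union> events_of M (C t) (count_space requests) \<union>
     events_of M (Q t) (count_space requests)"

definition history :: "nat \<Rightarrow> 'w set set" where
  "history t =
     init_info n0 \<union>
     (\<Union>u\<in>{1..t}. decision_info u \<union>
        events_of M (s u) borel \<union> events_of M (\<rho> u) borel \<union> events_of M (y u) borel)"

definition sigma2 :: "nat \<Rightarrow> 'a \<Rightarrow> 'w \<Rightarrow> real" where
  "sigma2 t x \<omega> = post_var k v (data t \<omega>) x"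

definition unclassified :: "nat \<Rightarrow> 'w \<Rightarrow> 'a set" where
  "unclassified t \<omega> = (if t = 0 then \<Omega> else \<Omega> - classified \<Omega> k v h \<epsilon> \<beta> (data t \<omega>))"

text \<open>The first index \<open>t\<close> with no unclassified points left, \<open>\<infinity>\<close> if there is none.\<close>

definition completion_time :: "'w \<Rightarrow> enat" where
  "completion_time \<omega> = (INF t\<in>{t. unclassified t \<omega> = {}}. enat t)"

end

text \<open>A run in which trials are performed for every \<open>t \<ge> 1\<close>, without termination condition.
  The request in a greedy trial is any maximizer of the acquisition function, ties being broken
  arbitrarily. In \<open>s_law\<close>, conditional independence of the evaluated point and everything drawn
  before it, given the request, is written out elementarily, since there are only finitely many
  possible requests.\<close>

locale continued_run = run_processes D \<Omega> k v g \<theta> K c p \<kappa> M h \<epsilon> \<beta> f n0 s0 \<rho>0 y0 r C Q s \<rho> y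
  for D \<Omega> :: "'a::euclidean_space set" and k v and g :: "'p \<Rightarrow> 'a \<Rightarrow> real" and \<theta> K c p \<kappa>
    and M :: "'w measure" and h \<epsilon> \<beta> f n0 s0 \<rho>0 y0 r C Q s \<rho> y +
  assumes f_prior: "gaussian_process M D k f"
    and s0_measurable: "\<And>j. j < n0 \<Longrightarrow> random_variable borel (s0 j)"
    and s0_in_D: "\<And>j \<omega>. j < n0 \<Longrightarrow> \<omega> \<in> space M \<Longrightarrow> s0 j \<omega> \<in> D"
    and \<rho>0_law: "\<And>j. j < n0 \<Longrightarrow> distributed M lborel (\<rho>0 j) (normal_density 0 (sqrt v))"
    and \<rho>0_indep: "\<And>j. j < n0 \<Longrightarrow>
      indep_of M (\<rho>0 j) borel (init_info j \<union> events_of M (s0 j) borel)"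
    and y0_measurable: "\<And>j. j < n0 \<Longrightarrow> random_variable borel (y0 j)"
    and y0_eq: "\<And>j \<omega>. j < n0 \<Longrightarrow> \<omega> \<in> space M \<Longrightarrow> y0 j \<omega> = f (s0 j \<omega>) \<omega> + \<rho>0 j \<omega>"
    and r_measurable: "\<And>t. 1 \<le> t \<Longrightarrow> random_variable (count_space UNIV) (r t)"
    and r_law: "\<And>t. 1 \<le> t \<Longrightarrow>
      distr M (count_space UNIV) (r t) = measure_pmf (bernoulli_pmf (p t))"
    and r_indep: "\<And>t. 1 \<le> t \<Longrightarrow>
      indep_of M (r t) (count_space UNIV) (history (t - 1))"
    and C_measurable: "\<And>t. 1 \<le> t \<Longrightarrow> random_variable (count_space requests) (C t)"
    and C_law: "\<And>t x i. 1 \<le> t \<Longrightarrow> x \<in> \<Omega> \<Longrightarrow> i \<in> {1..K} \<Longrightarrow>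
      prob {\<omega> \<in> space M. C t \<omega> = (x, i)} = \<kappa> i"
    and C_indep: "\<And>t. 1 \<le> t \<Longrightarrow>
      indep_of M (C t) (count_space requests)
        (history (t - 1) \<union> events_of M (r t) (count_space UNIV))"
    and Q_measurable: "\<And>t. 1 \<le> t \<Longrightarrow> random_variable (count_space requests) (Q t)"
    and Q_random: "\<And>t \<omega>. 1 \<le> t \<Longrightarrow> \<omega> \<in> space M \<Longrightarrow> r t \<omega> \<Longrightarrow> Q t \<omega> = C t \<omega>"
    and Q_greedy: "\<And>t \<omega>. 1 \<le> t \<Longrightarrow> \<omega> \<in> space M \<Longrightarrow> \<not> r t \<omega> \<Longrightarrow>
      is_arg_max (\<lambda>(x, i). acquisition D \<Omega> k v g \<theta> h \<epsilon> \<beta> (data (t - 1) \<omega>) x (c i))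
        (\<lambda>q. q \<in> requests) (Q t \<omega>)"
    and s_measurable: "\<And>t. 1 \<le> t \<Longrightarrow> random_variable borel (s t)"
    and s_in_D: "\<And>t \<omega>. 1 \<le> t \<Longrightarrow> \<omega> \<in> space M \<Longrightarrow> s t \<omega> \<in> D"
    and s_law: "\<And>t x i A B. 1 \<le> t \<Longrightarrow> x \<in> \<Omega> \<Longrightarrow> i \<in> {1..K} \<Longrightarrow> A \<in> sets borel \<Longrightarrow>
      B \<in> sigma_sets (space M) (history (t - 1) \<union> decision_info t) \<Longrightarrow>
      prob ({\<omega> \<in> space M. Q t \<omega> = (x, i) \<and> s t \<omega> \<in> A} \<inter> B) =
        measure (sampling_law g \<theta> x (c i)) A * prob ({\<omega> \<in> space M. Q t \<omega> = (x, i)} \<inter> B)"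
    and \<rho>_law: "\<And>t. 1 \<le> t \<Longrightarrow> distributed M lborel (\<rho> t) (normal_density 0 (sqrt v))"
    and \<rho>_indep: "\<And>t. 1 \<le> t \<Longrightarrow>
      indep_of M (\<rho> t) borel (history (t - 1) \<union> decision_info t \<union> events_of M (s t) borel)"
    and y_measurable: "\<And>t. 1 \<le> t \<Longrightarrow> random_variable borel (y t)"
    and y_eq: "\<And>t \<omega>. 1 \<le> t \<Longrightarrow> \<omega> \<in> space M \<Longrightarrow> y t \<omega> = f (s t \<omega>) \<omega> + \<rho> t \<omega>"

end

theory Submission
  imports Defs "Jordan_Normal_Form.Determinant"
begin

text \<open>The posterior variance at \<open>x\<close> is the least mean squared error of a linear predictor of
  \<open>f x\<close>. Predicting by the average of \<open>N\<close> observations made in a small neighbourhood of \<open>x\<close> has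
  error at most \<open>3 * \<delta> + v / N\<close>, where \<open>\<delta>\<close> is the oscillation of \<open>k\<close> near \<open>(x, x)\<close>; so it
  suffices that every neighbourhood of \<open>x\<close> is hit infinitely often. Whatever happened before,
  trial \<open>t\<close> hits it with probability at least \<open>p t\<close> times a positive constant, and \<open>\<Sum>p t\<close> diverges,
  so a conditional second Borel-Cantelli lemma applies.\<close>

unbundle no vec_syntax

section \<open>Symmetric and positive definite matrices\<close>

lemma symmetric_mat_mult_scalar_prod:
  fixes A :: "'a::comm_semiring_0 mat"
  assumes "A \<in> carrier_mat n n" "\<And>i j. i < n \<Longrightarrow> j < n \<Longrightarrow> A $$ (i, j) = A $$ (j, i)"
    and "u \<in> carrier_vec n" "w \<in> carrier_vec n"
  shows "scalar_prod u (A *\<^sub>v w) = scalar_prod (A *\<^sub>v u) w"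
proof -
  have "transpose_mat A = A"
    using assms(1,2) by (intro eq_matI) auto
  then show ?thesis
    using transpose_vec_mult_scalar[OF assms(1,4,3)] by simp
qed

text \<open>A singular \<open>A\<close> would have a nonzero null vector \<open>w\<close>, and then
  \<open>scalar_prod w (A *\<^sub>v w)\<close> would be 0. This guarantees that \<open>the\<close>
  is applied to a genuine inverse in \<open>obs_cov_inv\<close>.\<close>

lemma pos_def_mat_inverse:
  fixes A :: "real mat"
  assumes A: "A \<in> carrier_mat n n"
    and pos: "\<And>w. w \<in> carrier_vec n \<Longrightarrow> w \<noteq> 0\<^sub>v n \<Longrightarrow> 0 < scalar_prod w (A *\<^sub>v w)"
  shows "the (mat_inverse A) \<in> carrier_mat n n" "A * the (mat_inverse A) = 1\<^sub>m n"
proof -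
  have "Determinant.det A \<noteq> 0"
  proof
    assume "Determinant.det A = 0"
    then obtain w where "w \<in> carrier_vec n" "w \<noteq> 0\<^sub>v n" "A *\<^sub>v w = 0\<^sub>v n"
      using det_0_iff_vec_prod_zero_field[OF A] by auto
    then show False
      using pos[of w] by simp
  qed
  then obtain B where "mat_inverse A = Some B"
    using det_non_zero_imp_unit[OF A] mat_inverse(1)[OF A] by fastforce
  then show "the (mat_inverse A) \<in> carrier_mat n n" "A * the (mat_inverse A) = 1\<^sub>m n"
    using mat_inverse(2)[OF A] by auto
qed

section \<open>The posterior variance as a minimal prediction error\<close>

text \<open>\<open>pd_kernel\<close> speaks of sets of points, whereas a point may be evaluated
  several times. Adding up the coefficients of equal points, as \<open>b\<close> does, reduces
  families to sets.\<close>

lemma pd_kernel_family: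
  assumes k: "pd_kernel D k" and I: "finite I" and z: "z ` I \<subseteq> D"
  shows "0 \<le> (\<Sum>i\<in>I. \<Sum>j\<in>I. a i * a j * k (z i) (z j))"
proof -
  define b where "b x = (\<Sum>i | i \<in> I \<and> z i = x. a i)" for x
  have group: "(\<Sum>i\<in>I. a i * F (z i)) = (\<Sum>x\<in>z ` I. b x * F x)" for F
  proof -
    have "(\<Sum>i\<in>I. a i * F (z i)) = (\<Sum>x\<in>z ` I. \<Sum>i | i \<in> I \<and> z i = x. a i * F (z i))"
      by (rule sum.image_gen[OF I])
    also have "\<dots> = (\<Sum>x\<in>z ` I. b x * F x)"
      by (auto simp: b_def sum_distrib_right intro!: sum.cong)
    finally show ?thesis .
  qed
  have "(\<Sum>i\<in>I. \<Sum>j\<in>I. a i * a j * k (z i) (z j))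
      = (\<Sum>i\<in>I. a i * (\<Sum>j\<in>I. a j * k (z i) (z j)))"
    by (simp add: sum_distrib_left mult.assoc)
  also have "\<dots> = (\<Sum>x\<in>z ` I. b x * (\<Sum>x'\<in>z ` I. b x' * k x x'))"
    by (simp only: group[of "k (z i)" for i] group[of "\<lambda>y. \<Sum>x'\<in>z ` I. b x' * k y x'"])
  also have "\<dots> = (\<Sum>x\<in>z ` I. \<Sum>x'\<in>z ` I. b x * b x' * k x x')"
    by (simp add: sum_distrib_left mult.assoc)
  also have "\<dots> \<ge> 0"
    using k I z by (auto simp: pd_kernel_def)
  finally show ?thesis .
qed

text \<open>The mean squared error of predicting \<open>f x\<close> by the linear combination of the observations
  with coefficients \<open>a\<close>; the posterior variance is its minimum over all \<open>a\<close>.\<close>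

definition linear_pred_error ::
    "('a \<Rightarrow> 'a \<Rightarrow> real) \<Rightarrow> real \<Rightarrow> ('a \<times> real) list \<Rightarrow> 'a \<Rightarrow> (nat \<Rightarrow> real) \<Rightarrow> real" where
  "linear_pred_error k v obs x a =
     k x x - 2 * (\<Sum>i<length obs. a i * k (fst (obs ! i)) x)
     + (\<Sum>i<length obs. \<Sum>j<length obs. a i * a j * k (fst (obs ! i)) (fst (obs ! j)))
     + v * (\<Sum>i<length obs. (a i)\<^sup>2)"

text \<open>Apart from the noise term, the error is the kernel's quadratic form on the family
  consisting of the evaluated points with coefficients \<open>- a i\<close> and of \<open>x\<close>
  with coefficient 1. It is the variance of \<open>f x\<close> minus its prediction.\<close>

lemma linear_pred_error_nonneg:
  assumes k: "pd_kernel D k" and v: "0 \<le> v" and obs: "fst ` set obs \<subseteq> D" and x: "x \<in> D"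
  shows "0 \<le> linear_pred_error k v obs x a"
proof -
  let ?n = "length obs"
  \<comment> \<open>The index \<open>?n\<close>, one past the data, stands for the target point
    \<open>x\<close>.\<close>
  define z where "z i = (if i < ?n then fst (obs ! i) else x)" for i
  define b where "b i = (if i < ?n then - a i else 1)" for i
  have z_D: "z i \<in> D" if "i < Suc ?n" for i
    using that obs x by (auto simp: z_def)
  then have sym: "k (z i) x = k x (z i)" if "i < ?n" for i
    using k x that by (auto simp: pd_kernel_def)
  have "0 \<le> (\<Sum>i<Suc ?n. \<Sum>j<Suc ?n. b i * b j * k (z i) (z j))"
    by (rule pd_kernel_family[OF k]) (use z_D in auto)
  also have "\<dots> = k x x - 2 * (\<Sum>i<?n. a i * k (fst (obs ! i)) x)
     + (\<Sum>i<?n. \<Sum>j<?n. a i * a j * k (fst (obs ! i)) (fst (obs ! j)))"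
  proof -
    have "(\<Sum>i<?n. \<Sum>j<?n. b i * b j * k (z i) (z j))
        = (\<Sum>i<?n. \<Sum>j<?n. a i * a j * k (fst (obs ! i)) (fst (obs ! j)))"
      by (intro sum.cong) (auto simp: b_def z_def)
    moreover have "(\<Sum>i<?n. b i * b ?n * k (z i) (z ?n)) = - (\<Sum>i<?n. a i * k (fst (obs ! i)) x)"
      unfolding sum_negf[symmetric] by (intro sum.cong) (auto simp: b_def z_def)
    moreover have "(\<Sum>j<?n. b ?n * b j * k (z ?n) (z j)) = - (\<Sum>i<?n. a i * k (fst (obs ! i)) x)"
      unfolding sum_negf[symmetric] using sym by (intro sum.cong) (auto simp: b_def z_def)
    moreover have "b ?n * b ?n * k (z ?n) (z ?n) = k x x"
      by (simp add: b_def z_def)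
    ultimately show ?thesis
      by (simp only: sum.lessThan_Suc sum.distrib)
  qed
  finally have "0 \<le> \<dots>" .
  moreover have "0 \<le> v * (\<Sum>i<?n. (a i)\<^sup>2)"
    using v by (simp add: sum_nonneg)
  ultimately show ?thesis
    by (simp add: linear_pred_error_def)
qed

text \<open>Completing the square. For a coefficient vector \<open>u\<close> the error is a
  quadratic polynomial with matrix \<open>A\<close> and linear part given by \<open>b\<close>. It is
  stationary where \<open>A *\<^sub>v w = b\<close>, its value there is the posterior variance, and
  the error of \<open>u\<close> exceeds that value by the quadratic form of \<open>A\<close> at
  \<open>u - w\<close>.\<close>

lemma post_var_minimises:
  assumes k: "pd_kernel D k" and v: "0 < v" and obs: "fst ` set obs \<subseteq> D" and x: "x \<in> D"
  shows post_var_le_linear_pred_error: "post_var k v obs x \<le> linear_pred_error k v obs x a"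
    and post_var_attains: "\<exists>w. post_var k v obs x = linear_pred_error k v obs x w"
proof -
  let ?n = "length obs"
  define A where "A = kernel_mat k obs + v \<cdot>\<^sub>m 1\<^sub>m ?n"
  define b where "b = kernel_vec k obs x"
  have A: "A \<in> carrier_mat ?n ?n" and b: "b \<in> carrier_vec ?n"
    by (auto simp: A_def kernel_mat_def b_def kernel_vec_def)
  have A_nth: "A $$ (i, j) = k (fst (obs ! i)) (fst (obs ! j)) + (if i = j then v else 0)"
    if "i < ?n" "j < ?n" for i j
    using that by (auto simp: A_def kernel_mat_def)
  have obs_D: "fst (obs ! i) \<in> D" if "i < ?n" for i
    using obs that by auto
  have sym: "A $$ (i, j) = A $$ (j, i)" if "i < ?n" "j < ?n" for i j
    using k obs_D that by (auto simp: A_nth pd_kernel_def)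
  have quad: "scalar_prod w (A *\<^sub>v w)
      = (\<Sum>i<?n. \<Sum>j<?n. w $ i * w $ j * k (fst (obs ! i)) (fst (obs ! j))) + v * (\<Sum>i<?n. (w $ i)\<^sup>2)"
    if w: "w \<in> carrier_vec ?n" for w
  proof -
    have "scalar_prod w (A *\<^sub>v w) = (\<Sum>i<?n. w $ i * (\<Sum>j<?n. A $$ (i, j) * w $ j))"
      using w A by (auto simp: scalar_prod_def lessThan_atLeast0 intro!: sum.cong)
    also have "\<dots> = (\<Sum>i<?n. (\<Sum>j<?n. w $ i * w $ j * k (fst (obs ! i)) (fst (obs ! j))) + v * (w $ i)\<^sup>2)"
    proof (rule sum.cong[OF refl])
      fix i assume i: "i \<in> {..<?n}"
      have "(\<Sum>j<?n. A $$ (i, j) * w $ j)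
          = (\<Sum>j<?n. w $ j * k (fst (obs ! i)) (fst (obs ! j)) + (if i = j then v * w $ j else 0))"
        using i by (intro sum.cong) (auto simp: A_nth algebra_simps)
      also have "\<dots> = (\<Sum>j<?n. w $ j * k (fst (obs ! i)) (fst (obs ! j))) + v * w $ i"
        using i by (simp add: sum.distrib)
      finally show "w $ i * (\<Sum>j<?n. A $$ (i, j) * w $ j)
          = (\<Sum>j<?n. w $ i * w $ j * k (fst (obs ! i)) (fst (obs ! j))) + v * (w $ i)\<^sup>2"
        by (simp add: algebra_simps sum_distrib_left power2_eq_square)
    qed
    finally show ?thesis
      by (simp add: sum.distrib sum_distrib_left)
  qed
  have psd: "0 \<le> (\<Sum>i<?n. \<Sum>j<?n. w $ i * w $ j * k (fst (obs ! i)) (fst (obs ! j)))" for w :: "real vec"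
    by (rule pd_kernel_family[OF k]) (use obs_D in auto)
  \<comment> \<open>Strictness comes from the noise term, because the Gram matrix alone is only
    semidefinite.\<close>
  have pos: "0 < scalar_prod w (A *\<^sub>v w)" if w: "w \<in> carrier_vec ?n" "w \<noteq> 0\<^sub>v ?n" for w
  proof -
    obtain i where "i < ?n" "w $ i \<noteq> 0"
      using w by (metis carrier_vecD eq_vecI index_zero_vec)
    then have "0 < (\<Sum>i<?n. (w $ i)\<^sup>2)"
      by (intro sum_pos2[of _ i]) auto
    then show ?thesis
      using quad[OF w(1)] psd[of w] v by (simp add: add_nonneg_pos)
  qed
  have nonneg: "0 \<le> scalar_prod w (A *\<^sub>v w)" if "w \<in> carrier_vec ?n" for w
    using quad[OF that] psd[of w] v by (simp add: sum_nonneg)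
  define P where "P = the (mat_inverse A)"
  have P: "P \<in> carrier_mat ?n ?n" "A * P = 1\<^sub>m ?n"
    using pos_def_mat_inverse[OF A pos] by (auto simp: P_def)
  define w where "w = P *\<^sub>v b"
  have w: "w \<in> carrier_vec ?n"
    using P b by (auto simp: w_def)
  \<comment> \<open>This normal equation is all that the rest of the argument needs to know about
    the inverse.\<close>
  have Aw: "A *\<^sub>v w = b"
    using P b A by (metis assoc_mult_mat_vec one_mult_mat_vec w_def)
  have var: "post_var k v obs x = k x x - scalar_prod w b"
    using comm_scalar_prod[OF b w]
    by (simp add: post_var_def post_cov_def obs_cov_inv_def w_def b_def P_def A_def)
  have err: "linear_pred_error k v obs x a = k x x - 2 * scalar_prod u b + scalar_prod u (A *\<^sub>v u)"
    if "u = vec ?n a" for u a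
  proof -
    have "scalar_prod u b = (\<Sum>i<?n. a i * k (fst (obs ! i)) x)"
      using that by (simp add: scalar_prod_def b_def kernel_vec_def lessThan_atLeast0)
    moreover have "scalar_prod u (A *\<^sub>v u)
        = (\<Sum>i<?n. \<Sum>j<?n. a i * a j * k (fst (obs ! i)) (fst (obs ! j))) + v * (\<Sum>i<?n. (a i)\<^sup>2)"
      using quad[of u] that by simp
    ultimately show ?thesis
      by (simp add: linear_pred_error_def)
  qed
  have "w = vec ?n (\<lambda>i. w $ i)"
    using w by auto
  from err[OF this] have "linear_pred_error k v obs x (\<lambda>i. w $ i) = post_var k v obs x"
    using var Aw by simp
  then show "\<exists>w. post_var k v obs x = linear_pred_error k v obs x w"
    by metis
  define u where "u = vec ?n a"
  have u: "u \<in> carrier_vec ?n"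
    by (simp add: u_def)
  have Au: "A *\<^sub>v u \<in> carrier_vec ?n"
    using A u by simp
  have "0 \<le> scalar_prod (u - w) (A *\<^sub>v (u - w))"
    using nonneg u w by simp
  also have "\<dots> = scalar_prod (u - w) (A *\<^sub>v u) - scalar_prod (u - w) b"
    using u w b Au by (simp add: mult_minus_distrib_mat_vec[OF A] Aw scalar_prod_minus_distrib[of _ ?n])
  also have "\<dots> = scalar_prod u (A *\<^sub>v u) - scalar_prod w (A *\<^sub>v u) - (scalar_prod u b - scalar_prod w b)"
    using u w b Au by (simp add: minus_scalar_prod_distrib[of _ ?n])
  \<comment> \<open>By symmetry \<open>A\<close> moves over to \<open>w\<close>, so both cross terms
    equal \<open>scalar_prod u b\<close> and combine to the factor 2 in the error.\<close>
  also have "scalar_prod w (A *\<^sub>v u) = scalar_prod u b"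
    using symmetric_mat_mult_scalar_prod[OF A sym w u] comm_scalar_prod[OF u b] by (simp add: Aw)
  finally show "post_var k v obs x \<le> linear_pred_error k v obs x a"
    using err[OF u_def] var by simp
qed

lemma post_var_nonneg:
  assumes "pd_kernel D k" "0 < v" "fst ` set obs \<subseteq> D" "x \<in> D"
  shows "0 \<le> post_var k v obs x"
  using post_var_attains[OF assms] linear_pred_error_nonneg[of D k v obs x] assms by fastforce

text \<open>Predict \<open>f x\<close> by the average of the observations made in \<open>U\<close>.\<close>

lemma post_var_le_average:
  fixes obs :: "('a \<times> real) list"
  assumes k: "pd_kernel D k" and v: "0 < v" and obs: "fst ` set obs \<subseteq> D" and x: "x \<in> D" "x \<in> U"
    and close: "\<And>a b. a \<in> U \<Longrightarrow> b \<in> U \<Longrightarrow> \<bar>k a b - k x x\<bar> \<le> \<delta>"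
    and N: "0 < N" "N \<le> length (filter (\<lambda>d. fst d \<in> U) obs)"
  shows "post_var k v obs x \<le> 3 * \<delta> + v / real N"
proof -
  let ?n = "length obs"
  define J where "J = {i. i < ?n \<and> fst (obs ! i) \<in> U}"
  have J: "finite J" "J \<subseteq> {..<?n}" "N \<le> card J"
    using N by (auto simp: J_def length_filter_conv_card)
  define m where "m = real (card J)"
  have m: "0 < m" "real N \<le> m"
    using J N by (auto simp: m_def)
  \<comment> \<open>The weights use the actual number \<open>m\<close> of observations in
    \<open>U\<close> instead of \<open>N\<close>, so that they sum to 1; \<open>N\<close> returns
    only in the last estimate.\<close>
  define a where "a i = (if i \<in> J then 1 / m else 0)" for i
  have restrict: "(\<Sum>i<?n. a i * F i) = (\<Sum>i\<in>J. F i) / m" for F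
  proof -
    have "(\<Sum>i<?n. a i * F i) = (\<Sum>i\<in>J. F i / m)"
      using J by (intro sum.mono_neutral_cong_right) (auto simp: a_def)
    then show ?thesis
      by (simp add: sum_divide_distrib)
  qed
  have lin: "k x x - \<delta> \<le> (\<Sum>i<?n. a i * k (fst (obs ! i)) x)"
  proof -
    have "k x x - \<delta> \<le> k (fst (obs ! i)) x" if "i \<in> J" for i
      using close[of "fst (obs ! i)" x] that x by (simp add: J_def)
    then have "m * (k x x - \<delta>) \<le> (\<Sum>i\<in>J. k (fst (obs ! i)) x)"
      unfolding m_def by (rule sum_bounded_below)
    then show ?thesis
      using m by (simp add: restrict field_simps)
  qed
  have "(\<Sum>i<?n. \<Sum>j<?n. a i * a j * k (fst (obs ! i)) (fst (obs ! j)))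
      = (\<Sum>i<?n. a i * (\<Sum>j<?n. a j * k (fst (obs ! i)) (fst (obs ! j))))"
    by (simp add: sum_distrib_left mult.assoc)
  also have "\<dots> = (\<Sum>i\<in>J. (\<Sum>j\<in>J. k (fst (obs ! i)) (fst (obs ! j))) / m) / m"
    by (simp only: restrict)
  also have "\<dots> \<le> k x x + \<delta>"
  proof -
    have "k (fst (obs ! i)) (fst (obs ! j)) \<le> k x x + \<delta>" if "i \<in> J" "j \<in> J" for i j
      using close[of "fst (obs ! i)" "fst (obs ! j)"] that by (simp add: J_def)
    then have "(\<Sum>j\<in>J. k (fst (obs ! i)) (fst (obs ! j))) \<le> m * (k x x + \<delta>)" if "i \<in> J" for i
      unfolding m_def using that by (intro sum_bounded_above)
    then have "(\<Sum>j\<in>J. k (fst (obs ! i)) (fst (obs ! j))) / m \<le> k x x + \<delta>" if "i \<in> J" for i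
      using m that by (simp add: divide_le_eq mult.commute)
    then have "(\<Sum>i\<in>J. (\<Sum>j\<in>J. k (fst (obs ! i)) (fst (obs ! j))) / m) \<le> m * (k x x + \<delta>)"
      unfolding m_def by (intro sum_bounded_above)
    then show ?thesis
      using m by (simp add: divide_le_eq mult.commute)
  qed
  \<comment> \<open>The kernel terms are bounded by
    \<open>k x x - 2 * (k x x - \<delta>) + (k x x + \<delta>)\<close>, which is
    \<open>3 * \<delta>\<close>.\<close>
  finally have "linear_pred_error k v obs x a \<le> 3 * \<delta> + v * (\<Sum>i<?n. (a i)\<^sup>2)"
    using lin by (simp add: linear_pred_error_def)
  \<comment> \<open>This is \<open>restrict\<close> with \<open>a\<close> itself in the role of
    \<open>F\<close>.\<close>
  also have "(\<Sum>i<?n. (a i)\<^sup>2) = 1 / m"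
  proof -
    have "(\<Sum>i\<in>J. a i) = 1"
      using m by (simp add: a_def m_def)
    then show ?thesis
      by (simp add: restrict power2_eq_square)
  qed
  also have "v * (1 / m) \<le> v / real N"
    using m v N by (simp add: frac_le)
  finally show ?thesis
    using post_var_le_linear_pred_error[OF k v obs x(1)] by (meson add_left_mono order_trans)
qed

section \<open>A conditional second Borel-Cantelli lemma\<close>

text \<open>Each further trial multiplies the probability of no success since time \<open>m\<close>
  by at most \<open>1 - q t\<close>, hence by at most \<open>exp (- q t)\<close>, and the product
  tends to 0 because the sum of the exponents diverges. The bound on the conditional probability of
  success is expressed by testing against every event \<open>B\<close> of the past, which avoids
  conditional expectations.\<close>

lemma (in prob_space) conditional_Borel_Cantelli_AE:
  fixes G :: "nat \<Rightarrow> 'a set set"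
  assumes G: "\<And>t. sigma_algebra (space M) (G t)" "\<And>t. G t \<subseteq> events" "mono G"
    and E: "\<And>t. 1 \<le> t \<Longrightarrow> E t \<in> G t"
    and cond: "\<And>t B. B \<in> G t \<Longrightarrow> q (Suc t) * prob B \<le> prob (E (Suc t) \<inter> B)"
    and div: "filterlim (\<lambda>n. \<Sum>t = 1..n. q t) at_top sequentially"
  shows "AE \<omega> in M. infinite {t. 1 \<le> t \<and> \<omega> \<in> E t}"
proof -
  \<comment> \<open>The event that no success occurs in the \<open>n\<close> trials after time
    \<open>m\<close>; for \<open>n = 0\<close> it is the whole space.\<close>
  define F where "F m n = {\<omega> \<in> space M. \<forall>t\<in>{m<..m + n}. \<omega> \<notin> E t}" for m n
  have F: "F m n \<in> G (m + n)" for m n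
  proof (induction n)
    case 0
    then show ?case
      using sigma_algebra.sigma_sets_eq[OF G(1)] sigma_sets_top by (auto simp: F_def)
  next
    case (Suc n)
    interpret S: sigma_algebra "space M" "G (m + Suc n)"
      by (rule G(1))
    have "F m (Suc n) = F m n - E (m + Suc n)"
      by (auto simp: F_def le_Suc_eq)
    moreover have "F m n \<in> G (m + Suc n)"
      using Suc G(3) monoD[of G "m + n" "m + Suc n"] by auto
    ultimately show ?case
      using E[of "m + Suc n"] S.Diff by auto
  qed
  have F_ev: "F m n \<in> events" for m n
    using F G(2) by blast
  have E_ev: "E t \<in> events" if "1 \<le> t" for t
    using E[OF that] G(2) by blast
  have bound: "prob (F m n) \<le> exp (- (\<Sum>t\<in>{m<..m + n}. q t))" for m n
  proof (induction n)
    case 0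
    then show ?case by simp
  next
    case (Suc n)
    let ?t = "Suc (m + n)"
    have "F m (Suc n) = F m n - E ?t \<inter> F m n"
      by (auto simp: F_def le_Suc_eq)
    then have "prob (F m (Suc n)) = prob (F m n) - prob (E ?t \<inter> F m n)"
      using F_ev E_ev[of ?t] by (simp add: finite_measure_Diff)
    \<comment> \<open>\<open>F m n\<close> depends only on the trials before \<open>?t\<close>, so
      it may serve as \<open>B\<close> in \<open>cond\<close>.\<close>
    also have "\<dots> \<le> (1 + - q ?t) * prob (F m n)"
      using cond[OF F[of m n]] by (simp add: algebra_simps)
    also have "\<dots> \<le> exp (- q ?t) * prob (F m n)"
      by (intro mult_right_mono exp_ge_add_one_self) auto
    also have "\<dots> \<le> exp (- q ?t) * exp (- (\<Sum>t\<in>{m<..m + n}. q t))"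
      using Suc by simp
    also have "\<dots> = exp (- (\<Sum>t\<in>{m<..m + Suc n}. q t))"
    proof -
      have "{m<..m + Suc n} = insert ?t {m<..m + n}"
        by auto
      then show ?thesis
        by (simp add: exp_add[symmetric])
    qed
    finally show ?case .
  qed
  have "AE \<omega> in M. \<not> (\<forall>n. \<omega> \<in> F m n)" for m
  proof -
    have "(\<Sum>t\<in>{m<..m + n}. q t) = (\<Sum>t = 1..n + m. q t) - (\<Sum>t = 1..m. q t)" for n
    proof -
      have "{1..n + m} = {1..m} \<union> {m<..m + n}"
        by auto
      then have "(\<Sum>t = 1..n + m. q t) = (\<Sum>t = 1..m. q t) + (\<Sum>t\<in>{m<..m + n}. q t)"
        by (simp only:) (subst sum.union_disjoint, auto)
      then show ?thesis by simp
    qed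
    \<comment> \<open>Removing the first \<open>m\<close> terms changes the partial sums by a
      constant and so preserves divergence.\<close>
    moreover have "filterlim (\<lambda>n. (\<Sum>t = 1..n + m. q t) - (\<Sum>t = 1..m. q t)) at_top sequentially"
      using filterlim_tendsto_add_at_top[OF tendsto_const[of "- (\<Sum>t = 1..m. q t)"]
          filterlim_compose[OF div filterlim_add_const_nat_at_top[of m]]] by simp
    ultimately have "(\<lambda>n. exp (- (\<Sum>t\<in>{m<..m + n}. q t))) \<longlonglongrightarrow> 0"
      by (simp add: filterlim_uminus_at_top filterlim_compose[OF exp_at_bot])
    then have lim: "(\<lambda>n. prob (F m n)) \<longlonglongrightarrow> 0"
      by (rule tendsto_sandwich[rotated -1]) (use bound in auto)
    have "prob (\<Inter>n. F m n) \<le> prob (F m n)" for n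
      using F_ev by (intro finite_measure_mono) auto
    then have "prob (\<Inter>n. F m n) \<le> 0"
      using lim by (intro LIMSEQ_le_const) auto
    then have "prob (\<Inter>n. F m n) = 0"
      using measure_nonneg[of M] by (simp add: order_antisym)
    then have "(\<Inter>n. F m n) \<in> null_sets M"
      using F_ev by (auto simp: null_sets_def emeasure_eq_measure)
    then show ?thesis
      by (rule AE_I') auto
  qed
  then have "AE \<omega> in M. \<forall>m. \<not> (\<forall>n. \<omega> \<in> F m n)"
    by (simp add: AE_all_countable)
  with AE_space show ?thesis
  proof eventually_elim
    case (elim \<omega>)
    show ?case
      unfolding infinite_nat_iff_unbounded
    proof
      fix m
      obtain n where "\<omega> \<notin> F m n"
        using elim by blast
      then obtain t where "t \<in> {m<..m + n}" "\<omega> \<in> E t"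
        using elim(1) by (auto simp: F_def)
      then show "\<exists>t>m. t \<in> {t. 1 \<le> t \<and> \<omega> \<in> E t}"
        by (intro exI[of _ t]) auto
    qed
  qed
qed

section \<open>Events generated by random variables\<close>

lemma events_of_subset:
  "X \<in> measurable M N \<Longrightarrow> events_of M X N \<subseteq> sets M"
  by (auto simp: events_of_def measurable_sets)

lemma events_ofI:
  "A \<in> sets N \<Longrightarrow> X -` A \<inter> space M \<in> events_of M X N"
  by (auto simp: events_of_def)

lemma distributed_lborel_measurable:
  "distributed M lborel X F \<Longrightarrow> X \<in> borel_measurable M"
  using distributed_measurable[of M lborel X F] by simp

lemma sigma_sets_subset_sets_Int:
  assumes "\<A> \<subseteq> sets M" "A \<in> sigma_sets (space M) \<A>" "B \<in> sigma_sets (space M) \<A>"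
  shows "A \<inter> B \<in> sigma_sets (space M) \<A>"
proof -
  interpret S: sigma_algebra "space M" "sigma_sets (space M) \<A>"
    using assms(1) sets.space_closed by (intro sigma_algebra_sigma_sets) blast
  show ?thesis
    using assms by blast
qed

section \<open>Convergence of the posterior variance along a single run\<close>

context continued_run
begin

lemma data_in_D:
  assumes "\<omega> \<in> space M"
  shows "fst ` set (data t \<omega>) \<subseteq> D"
  using assms s0_in_D s_in_D by (auto simp: data_def)

text \<open>Equality may fail because initial data points can lie in \<open>U\<close> too.\<close>

lemma card_le_length_filter_data:
  "card {u \<in> {1..t}. s u \<omega> \<in> U} \<le> length (filter (\<lambda>d. fst d \<in> U) (data t \<omega>))"
proof -
  have "card {u \<in> {1..t}. s u \<omega> \<in> U} = length (filter (\<lambda>u. s u \<omega> \<in> U) [1..<Suc t])"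
    by (subst distinct_card[symmetric]) (auto intro!: arg_cong[where f = card])
  then show ?thesis
    by (simp add: data_def filter_map o_def del: upt_Suc)
qed

text \<open>The part of the argument without probability: \<open>post_var_le_average\<close> is
  applied with oscillation \<open>e / 6\<close> and with \<open>N\<close> so large that
  \<open>v / N < e / 2\<close>, which bounds the variance strictly below \<open>e\<close>.\<close>

lemma sigma2_tendsto_zero:
  assumes \<omega>: "\<omega> \<in> space M" and x: "x \<in> \<Omega>"
    and cont: "continuous (at (x, x) within D \<times> D) (\<lambda>(a, b). k a b)"
    and inf: "\<And>\<eta>. 0 < \<eta> \<Longrightarrow> infinite {t. 1 \<le> t \<and> s t \<omega> \<in> nbhd D x \<eta>}"
  shows "(\<lambda>t. sigma2 t x \<omega>) \<longlonglongrightarrow> 0"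
proof (rule LIMSEQ_I)
  fix e :: real assume e: "0 < e"
  have xD: "x \<in> D"
    using x \<Omega> by auto
  obtain \<eta> where \<eta>: "0 < \<eta>"
    "\<And>a b. a \<in> D \<Longrightarrow> b \<in> D \<Longrightarrow> dist (a, b) (x, x) < \<eta> \<Longrightarrow> dist (k a b) (k x x) < e / 6"
    using cont e unfolding continuous_within_eps_delta
    by (auto simp: dest!: spec[of _ "e / 6"])
  \<comment> \<open>The radius is halved because the distance of a pair from \<open>(x, x)\<close>
    is bounded by the sum of the two distances from \<open>x\<close>.\<close>
  let ?U = "nbhd D x (\<eta> / 2)"
  have close: "\<bar>k a b - k x x\<bar> \<le> e / 6" if "a \<in> ?U" "b \<in> ?U" for a b
  proof -
    have "dist (a, b) (x, x) \<le> dist a x + dist b x"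
      by (simp add: dist_prod_def sqrt_sum_squares_le_sum)
    also have "\<dots> < \<eta>"
      using that by (simp add: nbhd_def dist_norm)
    finally show ?thesis
      using \<eta>(2)[of a b] that by (simp add: nbhd_def dist_real_def)
  qed
  obtain N :: nat where N: "0 < N" "v / real N < e / 2"
  proof -
    obtain n where n: "v * 2 / e < real n"
      using reals_Archimedean2 by blast
    have "0 < v * 2 / e"
      using e noise_variance by simp
    then have "0 < n"
      using n by (cases n) auto
    then show ?thesis
      using n e that[of n] by (simp add: field_simps)
  qed
  obtain T where T: "finite T" "card T = N" "T \<subseteq> {t. 1 \<le> t \<and> s t \<omega> \<in> ?U}"
    using infinite_arbitrarily_large[OF inf[of "\<eta> / 2"], of N] \<eta> by auto
  \<comment> \<open>From time \<open>Max T\<close> on, the data contain all \<open>N\<close>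
    selected hits. Data only accumulate, so one bound serves all later times.\<close>
  have "norm (sigma2 t x \<omega> - 0) < e" if "Max T \<le> t" for t
  proof -
    have "T \<subseteq> {u \<in> {1..t}. s u \<omega> \<in> ?U}"
      using T that by (auto dest: Max_ge[OF T(1)])
    then have "N \<le> card {u \<in> {1..t}. s u \<omega> \<in> ?U}"
      using T(2) card_mono[of "{u \<in> {1..t}. s u \<omega> \<in> ?U}" T] by simp
    then have "N \<le> length (filter (\<lambda>d. fst d \<in> ?U) (data t \<omega>))"
      using card_le_length_filter_data order_trans by blast
    moreover have "x \<in> ?U"
      using xD \<eta> by (simp add: nbhd_def)
    ultimately have "sigma2 t x \<omega> \<le> 3 * (e / 6) + v / real N"
      unfolding sigma2_def
      using post_var_le_average[OF kernel noise_variance data_in_D[OF \<omega>] xD _ close N(1)] by blast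
    moreover have "0 \<le> sigma2 t x \<omega>"
      unfolding sigma2_def by (rule post_var_nonneg[OF kernel noise_variance data_in_D[OF \<omega>] xD])
    ultimately show ?thesis
      using N(2) unfolding real_norm_def by linarith
  qed
  then show "\<exists>no. \<forall>n\<ge>no. norm (sigma2 n x \<omega> - 0) < e"
    by blast
qed

section \<open>Hitting a set infinitely often\<close>

lemma decision_info_events:
  assumes "1 \<le> t" shows "decision_info t \<subseteq> events"
  using assms events_of_subset[OF r_measurable] events_of_subset[OF C_measurable]
    events_of_subset[OF Q_measurable] by (simp add: decision_info_def)

lemma history_events: "history t \<subseteq> events"
proof -
  have "init_info n0 \<subseteq> events"
    unfolding init_info_def
    using f_prior s0_measurable y0_measurable distributed_lborel_measurable[OF \<rho>0_law]
    by (intro Un_least UN_least events_of_subset) (auto simp: gaussian_process_def)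
  moreover have "decision_info u \<union> events_of M (s u) borel \<union> events_of M (\<rho> u) borel \<union>
      events_of M (y u) borel \<subseteq> events" if "1 \<le> u" for u
    using that decision_info_events events_of_subset[OF s_measurable] events_of_subset[OF y_measurable]
      events_of_subset[OF distributed_lborel_measurable[OF \<rho>_law]] by simp
  ultimately show ?thesis
    by (simp add: history_def UN_subset_iff)
qed

text \<open>The factors are collected in the order of the draws: \<open>r t\<close> is independent
  of the past, \<open>C t\<close> of the past together with \<open>r t\<close>, and
  \<open>s t\<close> follows its sampling law once the request is fixed. In a random trial that
  request is \<open>C t\<close>, so no knowledge of the greedy choice is required.\<close>

lemma prob_random_hit:
  assumes t: "1 \<le> t" and x': "x' \<in> \<Omega>" and i: "i \<in> {1..K}" and A: "A \<in> sets borel"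
    and B: "B \<in> sigma_sets (space M) (history (t - 1))"
  shows "prob ({\<omega> \<in> space M. r t \<omega> \<and> C t \<omega> = (x', i) \<and> s t \<omega> \<in> A} \<inter> B) =
    p t * (\<kappa> i * measure (sampling_law g \<theta> x' (c i)) A) * prob B"
proof -
  let ?R = "r t -` {True} \<inter> space M"
  let ?C = "C t -` {(x', i)} \<inter> space M"
  have B_ev: "B \<in> events"
    using B sets.sigma_sets_subset[OF history_events] by blast
  have B_sub: "B \<subseteq> space M"
    using B_ev sets.sets_into_space by blast
  have R_dec: "?R \<in> decision_info t" and C_dec: "?C \<in> decision_info t"
    using x' i by (auto simp: decision_info_def intro!: events_ofI)
  have R: "prob ?R = p t"
  proof -
    have "prob ?R = measure (distr M (count_space UNIV) (r t)) {True}"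
      using r_measurable[OF t] by (simp add: measure_distr)
    also have "\<dots> = p t"
      using p_range[OF t] by (simp add: r_law[OF t] measure_pmf_single)
    finally show ?thesis .
  qed
  have RB: "prob (?R \<inter> B) = p t * prob B"
    using r_indep[OF t] R B events_ofI[of "{True}" "count_space UNIV" "r t"]
    unfolding indep_of_def by (subst indep_setD) auto
  \<comment> \<open>The outcome of \<open>r t\<close> is adjoined to the past, so that independence
    of \<open>C t\<close> applies to the joint event.\<close>
  have "?R \<inter> B \<in> sigma_sets (space M) (history (t - 1) \<union> events_of M (r t) (count_space UNIV))"
    (is "_ \<in> ?S")
  proof -
    have "B \<in> ?S"
      using B sigma_sets_mono'[of "history (t - 1)"] by blast
    moreover have "?R \<in> ?S"
      by (intro sigma_sets.Basic UnI2 events_ofI) auto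
    moreover have "history (t - 1) \<union> events_of M (r t) (count_space UNIV) \<subseteq> events"
      using history_events events_of_subset[OF r_measurable[OF t]] by blast
    ultimately show ?thesis
      by (metis sigma_sets_subset_sets_Int)
  qed
  then have "prob (?C \<inter> (?R \<inter> B)) = prob ?C * prob (?R \<inter> B)"
    using C_indep[OF t] x' i unfolding indep_of_def
    by (intro indep_setD) (auto intro!: events_ofI)
  moreover have "prob ?C = \<kappa> i"
    using C_law[OF t x' i] by (simp add: vimage_def Int_def conj_commute)
  ultimately have CRB: "prob (?C \<inter> (?R \<inter> B)) = \<kappa> i * (p t * prob B)"
    by (simp add: RB)
  have "?C \<inter> (?R \<inter> B) \<in> sigma_sets (space M) (history (t - 1) \<union> decision_info t)" (is "_ \<in> ?S")
  proof -
    have "B \<in> ?S"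
      using B sigma_sets_mono'[of "history (t - 1)"] by blast
    moreover have "?R \<in> ?S" "?C \<in> ?S"
      using R_dec C_dec by auto
    moreover have "history (t - 1) \<union> decision_info t \<subseteq> events"
      using history_events decision_info_events[OF t] by blast
    ultimately show ?thesis
      by (metis sigma_sets_subset_sets_Int)
  qed
  from s_law[OF t x' i A this]
  have "prob ({\<omega> \<in> space M. Q t \<omega> = (x', i) \<and> s t \<omega> \<in> A} \<inter> (?C \<inter> (?R \<inter> B))) =
      measure (sampling_law g \<theta> x' (c i)) A *
      prob ({\<omega> \<in> space M. Q t \<omega> = (x', i)} \<inter> (?C \<inter> (?R \<inter> B)))" .
  \<comment> \<open>On \<open>?R\<close> the request equals \<open>C t\<close>, so on
    \<open>?R \<inter> ?C\<close> the condition on \<open>Q t\<close> holds automatically.\<close>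
  moreover have "{\<omega> \<in> space M. Q t \<omega> = (x', i)} \<inter> (?C \<inter> (?R \<inter> B)) = ?C \<inter> (?R \<inter> B)"
    using Q_random[OF t] by auto
  moreover have "{\<omega> \<in> space M. Q t \<omega> = (x', i) \<and> s t \<omega> \<in> A} \<inter> (?C \<inter> (?R \<inter> B)) =
      {\<omega> \<in> space M. r t \<omega> \<and> C t \<omega> = (x', i) \<and> s t \<omega> \<in> A} \<inter> B"
    using Q_random[OF t] by auto
  ultimately show ?thesis
    using CRB by simp
qed

text \<open>Borel-Cantelli for the filtration generated by \<open>history\<close>: given any past
  event, trial \<open>t\<close> is a random trial with request \<open>(x', i)\<close> and a hit of
  \<open>A\<close> with probability exactly \<open>p t * \<gamma>\<close>, and these numbers still
  have a divergent sum.\<close>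

lemma AE_sample_infinitely_often:
  assumes A1: "filterlim (\<lambda>n. \<Sum>t = 1..n. p t) at_top sequentially"
    and x': "x' \<in> \<Omega>" and i: "i \<in> {1..K}" and A: "A \<in> sets borel"
    and pos: "0 < measure (sampling_law g \<theta> x' (c i)) A"
  shows "AE \<omega> in M. infinite {t. 1 \<le> t \<and> s t \<omega> \<in> A}"
proof -
  define \<gamma> where "\<gamma> = \<kappa> i * measure (sampling_law g \<theta> x' (c i)) A"
  \<comment> \<open>Only hits in random trials with the request \<open>(x', i)\<close> are counted;
    they form a subset of all hits of \<open>A\<close>, so infinitely many of them suffice.\<close>
  define E where "E t = {\<omega> \<in> space M. r t \<omega> \<and> C t \<omega> = (x', i) \<and> s t \<omega> \<in> A}" for t
  have \<gamma>: "0 < \<gamma>"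
    using \<kappa>_range[OF i] pos by (simp add: \<gamma>_def)
  have "AE \<omega> in M. infinite {t. 1 \<le> t \<and> \<omega> \<in> E t}"
  proof (rule conditional_Borel_Cantelli_AE)
    show "sigma_algebra (space M) (sigma_sets (space M) (history t))" for t
      using history_events sets.space_closed by (intro sigma_algebra_sigma_sets) blast
    show "sigma_sets (space M) (history t) \<subseteq> events" for t
      by (rule sets.sigma_sets_subset[OF history_events])
    show "mono (\<lambda>t. sigma_sets (space M) (history t))"
      by (intro monoI sigma_sets_mono') (auto simp: history_def)
    show "E t \<in> sigma_sets (space M) (history t)" if t: "1 \<le> t" for t
    proof -
      have "r t -` {True} \<inter> space M \<in> history t" "C t -` {(x', i)} \<inter> space M \<in> history t"
        "s t -` A \<inter> space M \<in> history t"
        using t x' i A by (auto simp: history_def decision_info_def intro!: bexI[of _ t] events_ofI)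
      then have "(r t -` {True} \<inter> space M) \<inter> (C t -` {(x', i)} \<inter> space M) \<inter> (s t -` A \<inter> space M)
          \<in> sigma_sets (space M) (history t)"
        by (intro sigma_sets_subset_sets_Int[OF history_events] sigma_sets.Basic[of _ "history t"])
      moreover have "(r t -` {True} \<inter> space M) \<inter> (C t -` {(x', i)} \<inter> space M) \<inter> (s t -` A \<inter> space M) = E t"
        by (auto simp: E_def)
      ultimately show ?thesis by simp
    qed
    show "p (Suc t) * \<gamma> * prob B \<le> prob (E (Suc t) \<inter> B)"
      if "B \<in> sigma_sets (space M) (history t)" for t B
      using prob_random_hit[of "Suc t" x' i A B] that x' i A by (simp add: E_def \<gamma>_def)
    show "filterlim (\<lambda>n. \<Sum>t = 1..n. p t * \<gamma>) at_top sequentially"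
      using filterlim_at_top_mult_tendsto_pos[OF tendsto_const \<gamma> A1] by (simp add: sum_distrib_right)
  qed
  then show ?thesis
    by eventually_elim (erule infinite_super[rotated], auto simp: E_def)
qed

section \<open>Almost sure convergence and termination\<close>

text \<open>Infinitely many hits are needed for every point and every radius outside one common null
  set. Restricting the radii to \<open>inverse (real (Suc j))\<close> leaves countably many
  exceptional sets, as \<open>\<Omega>\<close> is finite, and smaller neighbourhoods lie inside
  larger ones.\<close>

lemma AE_sigma2_tendsto_zero:
  assumes A1: "filterlim (\<lambda>n. \<Sum>t = 1..n. p t) at_top sequentially"
    and A2: "\<And>x \<eta>. x \<in> \<Omega> \<Longrightarrow> 0 < \<eta> \<Longrightarrow>
      \<exists>x'\<in>\<Omega>. \<exists>i\<in>{1..K}. measure (sampling_law g \<theta> x' (c i)) (nbhd D x \<eta>) > 0"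
    and A3: "\<And>x. x \<in> \<Omega> \<Longrightarrow> continuous (at (x, x) within D \<times> D) (\<lambda>(a, b). k a b)"
  shows "AE \<omega> in M. \<forall>x\<in>\<Omega>. (\<lambda>t. sigma2 t x \<omega>) \<longlonglongrightarrow> 0"
proof -
  have nbhd_borel: "nbhd D x \<eta> \<in> sets borel" for x \<eta>
  proof -
    have "nbhd D x \<eta> = D \<inter> ball x \<eta>"
      by (auto simp: nbhd_def dist_norm norm_minus_commute)
    then show ?thesis
      using D_borel by simp
  qed
  have "AE \<omega> in M. infinite {t. 1 \<le> t \<and> s t \<omega> \<in> nbhd D x (inverse (real (Suc j)))}"
    if "x \<in> \<Omega>" for x j
  proof -
    obtain x' i where "x' \<in> \<Omega>" "i \<in> {1..K}"
      "0 < measure (sampling_law g \<theta> x' (c i)) (nbhd D x (inverse (real (Suc j))))"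
      using A2[OF \<open>x \<in> \<Omega>\<close>, of "inverse (real (Suc j))"] by auto
    then show ?thesis
      using AE_sample_infinitely_often[OF A1 _ _ nbhd_borel] by blast
  qed
  then have "AE \<omega> in M. \<forall>x\<in>\<Omega>. \<forall>j. infinite {t. 1 \<le> t \<and> s t \<omega> \<in> nbhd D x (inverse (real (Suc j)))}"
    using \<Omega>(2) by (simp add: AE_finite_all AE_all_countable)
  with AE_space show ?thesis
  proof eventually_elim
    case (elim \<omega>)
    show ?case
    proof
      fix x assume x: "x \<in> \<Omega>"
      show "(\<lambda>t. sigma2 t x \<omega>) \<longlonglongrightarrow> 0"
      proof (rule sigma2_tendsto_zero[OF _ x A3[OF x]])
        show "infinite {t. 1 \<le> t \<and> s t \<omega> \<in> nbhd D x \<eta>}" if "0 < \<eta>" for \<eta>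
        proof -
          obtain j where "inverse (real (Suc j)) < \<eta>"
            using reals_Archimedean[OF \<open>0 < \<eta>\<close>] by auto
          then have "nbhd D x (inverse (real (Suc j))) \<subseteq> nbhd D x \<eta>"
            by (auto simp: nbhd_def)
          then show ?thesis
            using elim x by (elim ballE allE[of _ j] infinite_super[rotated]) auto
        qed
      qed (use elim in simp)
    qed
  qed
qed

text \<open>Whichever side of \<open>h\<close> the posterior mean lies on, a confidence band of half-width below \<open>\<epsilon>\<close>
  stays within \<open>\<epsilon>\<close> of that side, so the values of the means play no role.\<close>

lemma completion_time_finite:
  assumes \<epsilon>: "0 < \<epsilon>" and lim: "\<forall>x\<in>\<Omega>. (\<lambda>t. sigma2 t x \<omega>) \<longlonglongrightarrow> 0"
  shows "completion_time \<omega> < \<infinity>"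
proof -
  have "\<forall>\<^sub>F t in sequentially. \<forall>x\<in>\<Omega>. sqrt \<beta> * sqrt (sigma2 t x \<omega>) < \<epsilon>"
  proof (intro eventually_ball_finite[OF \<Omega>(2)] ballI)
    fix x assume "x \<in> \<Omega>"
    then have "(\<lambda>t. sqrt \<beta> * sqrt (sigma2 t x \<omega>)) \<longlonglongrightarrow> sqrt \<beta> * sqrt 0"
      using lim by (intro tendsto_intros) auto
    then show "\<forall>\<^sub>F t in sequentially. sqrt \<beta> * sqrt (sigma2 t x \<omega>) < \<epsilon>"
      using \<epsilon> by (simp add: order_tendstoD(2))
  qed
  then obtain T where "\<forall>t\<ge>T. \<forall>x\<in>\<Omega>. sqrt \<beta> * sqrt (sigma2 t x \<omega>) < \<epsilon>"
    unfolding eventually_sequentially by blast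
  \<comment> \<open>An index of at least 1 is chosen, because \<open>unclassified\<close> at 0 is
    \<open>\<Omega>\<close> by convention, whatever the initial data say.\<close>
  then obtain t where t: "1 \<le> t" "\<And>x. x \<in> \<Omega> \<Longrightarrow> sqrt \<beta> * sqrt (sigma2 t x \<omega>) < \<epsilon>"
    using that[of "Suc T"] by simp
  have "x \<in> classified \<Omega> k v h \<epsilon> \<beta> (data t \<omega>)" if "x \<in> \<Omega>" for x
    using t(2)[OF that] that
    by (cases "h \<le> post_mean k v (data t \<omega>) x")
      (auto simp: classified_def high_set_def low_set_def lower_conf_def upper_conf_def sigma2_def)
  then have "unclassified t \<omega> = {}"
    using t(1) by (auto simp: unclassified_def)
  then have "completion_time \<omega> \<le> enat t"
    unfolding completion_time_def by (intro INF_lower) simp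
  then show ?thesis
    using enat_ord_simps(4) order_le_less_trans by blast
qed

end

theorem theorem2:
  fixes D \<Omega> :: "'a::euclidean_space set"
    and k :: "'a \<Rightarrow> 'a \<Rightarrow> real"
    and v h \<epsilon> \<beta> :: real
    and g :: "'p \<Rightarrow> 'a \<Rightarrow> real"
    and \<theta> :: "'a \<Rightarrow> real \<Rightarrow> 'p"
    and K n0 :: nat
    and c p \<kappa> :: "nat \<Rightarrow> real"
    and M :: "'w measure"
    and f :: "'a \<Rightarrow> 'w \<Rightarrow> real"
    and s0 s :: "nat \<Rightarrow> 'w \<Rightarrow> 'a"
    and \<rho>0 y0 \<rho> y :: "nat \<Rightarrow> 'w \<Rightarrow> real"
    and r :: "nat \<Rightarrow> 'w \<Rightarrow> bool"
    and C Q :: "nat \<Rightarrow> 'w \<Rightarrow> 'a \<times> nat"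
  assumes run: "continued_run D \<Omega> k v g \<theta> K c p \<kappa> M h \<epsilon> \<beta> f n0 s0 \<rho>0 y0 r C Q s \<rho> y"
    and eps_beta: "0 < \<epsilon>" "0 < \<beta>"
    and A1: "filterlim (\<lambda>n. \<Sum>t = 1..n. p t) at_top sequentially"
    and A2: "\<And>x \<eta>. x \<in> \<Omega> \<Longrightarrow> 0 < \<eta> \<Longrightarrow>
      \<exists>x'\<in>\<Omega>. \<exists>i\<in>{1..K}. measure (sampling_law g \<theta> x' (c i)) (nbhd D x \<eta>) > 0"
    and A3: "\<And>x. x \<in> \<Omega> \<Longrightarrow> continuous (at (x, x) within D \<times> D) (\<lambda>(a, b). k a b)"
  shows "(AE \<omega> in M. \<forall>x\<in>\<Omega>.
            (\<lambda>t. run_processes.sigma2 k v n0 s0 y0 s y t x \<omega>) \<longlonglongrightarrow> 0) \<and>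
         (AE \<omega> in M.
            run_processes.completion_time \<Omega> k v h \<epsilon> \<beta> n0 s0 y0 s y \<omega> < \<infinity>)"
proof -
  interpret continued_run D \<Omega> k v g \<theta> K c p \<kappa> M h \<epsilon> \<beta> f n0 s0 \<rho>0 y0 r C Q s \<rho> y
    by (rule run)
  have "AE \<omega> in M. \<forall>x\<in>\<Omega>. (\<lambda>t. sigma2 t x \<omega>) \<longlonglongrightarrow> 0"
    by (rule AE_sigma2_tendsto_zero[OF A1 A2 A3])
  moreover from this have "AE \<omega> in M. completion_time \<omega> < \<infinity>"
    by eventually_elim (rule completion_time_finite[OF eps_beta(1)])
  ultimately show ?thesis
    by blast
qed

end
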